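(* For every nonnegative integer $r$ there exists a form $f$ in 3 variables of degree 8 such that $H_f(x)$ is positive definite for all $x\in\mathbb{R}^3\setminus\{0\}$, but $f$ is not $r$-sos-convex.
   Context: $H_f(x)$ is the Hessian matrix of $f$ at $x$. A polynomial is a sum of squares if it equals $\sum_i q_i^2$ for polynomials $q_i$. For a nonnegative integer $r$, a polynomial $f$ in $x=(x_1,\dots,x_n)$ is called $r$-sos-convex if the polynomial $y^TH_f(x)y\cdot\left(\sum_{i=1}^n x_i^2\right)^r$ in the variables $(x,y)\in\mathbb{R}^{2n}$ is a sum of squares. *)

theory Defs
  imports "HOL-Analysis.Analysis"
begin

inductive polyfun :: "('a::euclidean_space \<Rightarrow> real) \<Rightarrow> bool" where
  const: "polyfun (\<lambda>x. c)"
| coord: "i \<in> Basis \<Longrightarrow> polyfun (\<lambda>x. x \<bullet> i)"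
| add: "polyfun p \<Longrightarrow> polyfun q \<Longrightarrow> polyfun (\<lambda>x. p x + q x)"
| mult: "polyfun p \<Longrightarrow> polyfun q \<Longrightarrow> polyfun (\<lambda>x. p x * q x)"

definition is_form :: "nat \<Rightarrow> ('a::euclidean_space \<Rightarrow> real) \<Rightarrow> bool" where
  "is_form d f \<longleftrightarrow> polyfun f \<and> (\<forall>t x. f (t *\<^sub>R x) = t ^ d * f x)"

definition sos :: "('a::euclidean_space \<Rightarrow> real) \<Rightarrow> bool" where
  "sos p \<longleftrightarrow> (\<exists>qs. (\<forall>q\<in>set qs. polyfun q) \<and> p = (\<lambda>z. \<Sum>q\<leftarrow>qs. (q z)^2))"

definition partial_deriv :: "'n::finite \<Rightarrow> (real^'n \<Rightarrow> real) \<Rightarrow> real^'n \<Rightarrow> real" where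
  "partial_deriv i f x = deriv (\<lambda>t. f (x + t *\<^sub>R axis i 1)) 0"

definition hessian :: "(real^'n::finite \<Rightarrow> real) \<Rightarrow> real^'n \<Rightarrow> real^'n^'n" where
  "hessian f x = (\<chi> i j. partial_deriv i (partial_deriv j f) x)"

definition pos_def :: "real^'n::finite^'n \<Rightarrow> bool" where
  "pos_def A \<longleftrightarrow> (\<forall>y. y \<noteq> 0 \<longrightarrow> y \<bullet> (A *v y) > 0)"

definition r_sos_convex :: "nat \<Rightarrow> (real^'n::finite \<Rightarrow> real) \<Rightarrow> bool" where
  "r_sos_convex r f \<longleftrightarrow>
     sos (\<lambda>(x::real^'n, y::real^'n). (y \<bullet> (hessian f x *v y)) * (\<Sum>i\<in>UNIV. (x $ i)^2) ^ r)"

end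

theory Submission
  imports Defs "HOL-Computational_Algebra.Polynomial"
begin

text \<open>
  Integrate a positive definite, non-sos ternary sextic \<open>p\<close> twice in \<open>z\<close> and add \<open>K (x\<^sup>2 + y\<^sup>2)\<^sup>4\<close>,
  which does not affect the \<open>zz\<close>-entry \<open>p\<close> of the Hessian. On the unit sphere the Hessian of the new
  term degenerates only at \<open>(0, 0, \<plusminus>1)\<close> or in the direction \<open>(0, 0, \<plusminus>1)\<close>, so by compactness some
  \<open>K\<close> makes the Hessian positive definite away from the origin. Finally replace \<open>(x, y, z)\<close> by
  \<open>(R x, R y, z)\<close> with \<open>R\<close> large, depending on \<open>r\<close>.

  If the result were \<open>r\<close>-sos-convex, \<open>p(R u, R v, 1) (u\<^sup>2 + v\<^sup>2 + 1)\<^sup>r\<close> would be a sum of squares, so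
  some square \<open>q\<^sup>2\<close> would lie below it and touch it at the origin. The \<open>(2, 2)\<close>-difference of \<open>q\<close> on the
  grid \<open>{-s, 0, s}\<^sup>2\<close> has a zero of order 4 at \<open>s = 0\<close>, whereas \<open>q\<close> is \<open>O(R\<^sup>3)\<close> for bounded \<open>(u, v)\<close> and has
  bounded degree; hence at \<open>s = 1/R\<close> the difference is \<open>O(1/R)\<close>. But \<open>p\<close> is tiny at the
  eight outer points of the grid and about 1 at its centre, a contradiction.
\<close>

section \<open>An octic form with positive definite Hessian\<close>

text \<open>
  Robinson's form, which vanishes at \<open>(\<plusminus>1, 0, 1)\<close>, \<open>(0, \<plusminus>1, 1)\<close>, \<open>(\<plusminus>1, \<plusminus>1, 1)\<close>, plus
  \<open>2 x\<^sup>2 (x\<^sup>2 - z\<^sup>2)\<^sup>2 + 2 y\<^sup>2 (y\<^sup>2 - z\<^sup>2)\<^sup>2\<close>, which keeps these zeros and makes the coefficients of \<open>z\<^sup>4 x\<^sup>2\<close>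
  and \<open>z\<^sup>4 y\<^sup>2\<close> positive, plus a small positive definite term.
\<close>
definition sextic :: "real \<Rightarrow> real \<Rightarrow> real \<Rightarrow> real" where
  "sextic x y z = z^6 + z^4 * (x^2 + y^2) + z^2 * (3 * x^2 * y^2 - 5 * x^4 - 5 * y^4)
     + (3 * x^6 + 3 * y^6 - x^4 * y^2 - x^2 * y^4) + (x^6 + y^6 + z^6) / 100"

definition octic :: "real \<Rightarrow> real \<Rightarrow> real \<Rightarrow> real \<Rightarrow> real" where
  "octic K x y z = (101/5600) * z^8 + z^6 * (x^2 + y^2) / 30
     + z^4 * (3 * x^2 * y^2 - 5 * x^4 - 5 * y^4) / 12
     + z^2 * ((301/100) * (x^6 + y^6) - x^4 * y^2 - x^2 * y^4) / 2 + K * (x^2 + y^2)^4"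

text \<open>Since \<open>octic\<close> is symmetric in \<open>x\<close> and \<open>y\<close>, the
  \<open>yy\<close> and \<open>yz\<close> entries of the Hessian arise from \<open>octic_xx\<close>
  and \<open>octic_xz\<close> by swapping arguments.\<close>

definition octic_xx :: "real \<Rightarrow> real \<Rightarrow> real \<Rightarrow> real \<Rightarrow> real" where
  "octic_xx K x y z = z^6 / 15 + z^4 * (y^2 - 10 * x^2) / 2
     + z^2 * ((903/10) * x^4 - 12 * x^2 * y^2 - 2 * y^4) / 2
     + K * (8 * (x^2 + y^2)^3 + 48 * (x^2 + y^2)^2 * x^2)"

definition octic_xy :: "real \<Rightarrow> real \<Rightarrow> real \<Rightarrow> real \<Rightarrow> real" where
  "octic_xy K x y z = z^4 * x * y - 4 * z^2 * (x^3 * y + x * y^3) + 48 * K * (x^2 + y^2)^2 * x * y"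

definition octic_xz :: "real \<Rightarrow> real \<Rightarrow> real \<Rightarrow> real" where
  "octic_xz x y z = 2/5 * z^5 * x + z^3 * (6 * x * y^2 - 20 * x^3) / 3
     + z * ((903/50) * x^5 - 4 * x^3 * y^2 - 2 * x * y^4)"

definition octic_x :: "real \<Rightarrow> real \<Rightarrow> real \<Rightarrow> real \<Rightarrow> real" where
  "octic_x K x y z = z^6 * x / 15 + z^4 * (6 * x * y^2 - 20 * x^3) / 12
     + z^2 * ((903/50) * x^5 - 4 * x^3 * y^2 - 2 * x * y^4) / 2 + 8 * K * (x^2 + y^2)^3 * x"

definition octic_z :: "real \<Rightarrow> real \<Rightarrow> real \<Rightarrow> real" where
  "octic_z x y z = (101/700) * z^7 + z^5 * (x^2 + y^2) / 5
     + z^3 * (3 * x^2 * y^2 - 5 * x^4 - 5 * y^4) / 3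
     + z * ((301/100) * (x^6 + y^6) - x^4 * y^2 - x^2 * y^4)"

section \<open>Derivatives of the octic and its Hessian under scaling\<close>

lemma octic_sym: "octic K x y z = octic K y x z"
  by (simp add: octic_def algebra_simps)

lemma octic_z_sym: "octic_z x y z = octic_z y x z"
  by (simp add: octic_z_def algebra_simps)

lemma has_deriv_octic_x:
  "((\<lambda>x. octic K x y z) has_real_derivative octic_x K x y z) (at x)"
  unfolding octic_def octic_x_def
  by (auto intro!: derivative_eq_intros simp: field_simps eval_nat_numeral)

lemma has_deriv_octic_y:
  "((\<lambda>y. octic K x y z) has_real_derivative octic_x K y x z) (at y)"
  using has_deriv_octic_x[of K x z y] by (simp add: octic_sym[of K x])

lemma has_deriv_octic_z:
  "((\<lambda>z. octic K x y z) has_real_derivative octic_z x y z) (at z)"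
  unfolding octic_def octic_z_def
  by (auto intro!: derivative_eq_intros simp: field_simps eval_nat_numeral)

lemma has_deriv_octic_xx:
  "((\<lambda>x. octic_x K x y z) has_real_derivative octic_xx K x y z) (at x)"
  unfolding octic_x_def octic_xx_def
  by (auto intro!: derivative_eq_intros simp: field_simps eval_nat_numeral)

lemma has_deriv_octic_xy:
  "((\<lambda>y. octic_x K x y z) has_real_derivative octic_xy K x y z) (at y)"
  unfolding octic_x_def octic_xy_def
  by (auto intro!: derivative_eq_intros simp: field_simps eval_nat_numeral)

lemma has_deriv_octic_xz:
  "((\<lambda>z. octic_x K x y z) has_real_derivative octic_xz x y z) (at z)"
  unfolding octic_x_def octic_xz_def
  by (auto intro!: derivative_eq_intros simp: field_simps eval_nat_numeral)

lemma has_deriv_octic_zx: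
  "((\<lambda>x. octic_z x y z) has_real_derivative octic_xz x y z) (at x)"
  unfolding octic_z_def octic_xz_def
  by (auto intro!: derivative_eq_intros simp: field_simps eval_nat_numeral)

lemma has_deriv_octic_zy:
  "((\<lambda>y. octic_z x y z) has_real_derivative octic_xz y x z) (at y)"
  using has_deriv_octic_zx[of x z y] by (simp add: octic_z_sym[of x])

lemma has_deriv_octic_zz:
  "((\<lambda>z. octic_z x y z) has_real_derivative sextic x y z) (at z)"
  unfolding octic_z_def sextic_def
  by (auto intro!: derivative_eq_intros simp: field_simps eval_nat_numeral)

lemma partial_deriv_scaled:
  fixes F :: "real \<Rightarrow> real \<Rightarrow> real \<Rightarrow> real" and R :: real
  defines "f \<equiv> \<lambda>x::real^3. F (R * x$1) (R * x$2) (x$3)"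
  shows "(\<And>x y z. ((\<lambda>x. F x y z) has_real_derivative D x y z) (at x)) \<Longrightarrow>
      partial_deriv 1 f = (\<lambda>x. R * D (R * x$1) (R * x$2) (x$3))"
    and "(\<And>x y z. ((\<lambda>y. F x y z) has_real_derivative D x y z) (at y)) \<Longrightarrow>
      partial_deriv 2 f = (\<lambda>x. R * D (R * x$1) (R * x$2) (x$3))"
    and "(\<And>x y z. ((\<lambda>z. F x y z) has_real_derivative D x y z) (at z)) \<Longrightarrow>
      partial_deriv 3 f = (\<lambda>x. D (R * x$1) (R * x$2) (x$3))"
proof -
  have lin: "((\<lambda>t. R * (c + t)) has_real_derivative R) (at t)" for c t
    by (auto intro!: derivative_eq_intros)
  have lin': "((\<lambda>t. c + t) has_real_derivative 1) (at t)" for c t :: real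
    by (auto intro!: derivative_eq_intros)
  {
    assume D: "\<And>x y z. ((\<lambda>x. F x y z) has_real_derivative D x y z) (at x)"
    show "partial_deriv 1 f = (\<lambda>x. R * D (R * x$1) (R * x$2) (x$3))"
    proof
      fix x :: "real^3"
      show "partial_deriv 1 f x = R * D (R * x$1) (R * x$2) (x$3)"
        unfolding partial_deriv_def f_def
        using DERIV_chain2[OF D lin[of "x$1" 0], of "R * x$2" "x$3"]
        by (intro DERIV_imp_deriv) (simp add: axis_def mult.commute)
    qed
  }
  {
    assume D: "\<And>x y z. ((\<lambda>y. F x y z) has_real_derivative D x y z) (at y)"
    show "partial_deriv 2 f = (\<lambda>x. R * D (R * x$1) (R * x$2) (x$3))"
    proof
      fix x :: "real^3"
      show "partial_deriv 2 f x = R * D (R * x$1) (R * x$2) (x$3)"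
        unfolding partial_deriv_def f_def
        using DERIV_chain2[OF D lin[of "x$2" 0], of "R * x$1" "x$3"]
        by (intro DERIV_imp_deriv) (simp add: axis_def mult.commute)
    qed
  }
  {
    assume D: "\<And>x y z. ((\<lambda>z. F x y z) has_real_derivative D x y z) (at z)"
    show "partial_deriv 3 f = (\<lambda>x. D (R * x$1) (R * x$2) (x$3))"
    proof
      fix x :: "real^3"
      show "partial_deriv 3 f x = D (R * x$1) (R * x$2) (x$3)"
        unfolding partial_deriv_def f_def
        using DERIV_chain2[OF D lin'[of "x$3" 0], of "R * x$1" "R * x$2"]
        by (intro DERIV_imp_deriv) (simp add: axis_def)
    qed
  }
qed

definition scaled_octic :: "real \<Rightarrow> real \<Rightarrow> real^3 \<Rightarrow> real" where
  "scaled_octic K R x = octic K (R * x$1) (R * x$2) (x$3)"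

definition octic_form :: "real \<Rightarrow> real^3 \<Rightarrow> real^3 \<Rightarrow> real" where
  "octic_form K x y = octic_xx K (x$1) (x$2) (x$3) * (y$1)^2 + octic_xx K (x$2) (x$1) (x$3) * (y$2)^2
     + sextic (x$1) (x$2) (x$3) * (y$3)^2 + 2 * octic_xy K (x$1) (x$2) (x$3) * y$1 * y$2
     + 2 * octic_xz (x$1) (x$2) (x$3) * y$1 * y$3 + 2 * octic_xz (x$2) (x$1) (x$3) * y$2 * y$3"

definition stretch :: "real \<Rightarrow> real^3 \<Rightarrow> real^3" where
  "stretch R x = vector [R * x$1, R * x$2, x$3]"

text \<open>Chain rule for the linear map \<open>S = stretch R\<close>: the Hessian becomes
  \<open>S^T H(S x) S\<close>, which moves \<open>S\<close> onto both arguments.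
  \<open>octic_form K\<close> is the quadratic form of the unscaled Hessian.\<close>

lemma hessian_scaled_octic:
  "y \<bullet> (hessian (scaled_octic K R) x *v y) = octic_form K (stretch R x) (stretch R y)"
proof -
  let ?f = "scaled_octic K R"
  have fx: "partial_deriv 1 ?f = (\<lambda>x. R * octic_x K (R * x$1) (R * x$2) (x$3))"
    unfolding scaled_octic_def by (rule partial_deriv_scaled(1)[OF has_deriv_octic_x])
  have fy: "partial_deriv 2 ?f = (\<lambda>x. R * octic_x K (R * x$2) (R * x$1) (x$3))"
    unfolding scaled_octic_def by (rule partial_deriv_scaled(2)[OF has_deriv_octic_y])
  have fz: "partial_deriv 3 ?f = (\<lambda>x. octic_z (R * x$1) (R * x$2) (x$3))"
    unfolding scaled_octic_def by (rule partial_deriv_scaled(3)[OF has_deriv_octic_z])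
  note c = DERIV_cmult[where c = R]
  have xy: "octic_xy K b a z = octic_xy K a b z" for a b z
    by (simp add: octic_xy_def algebra_simps)
  note d = partial_deriv_scaled(1)[where F = "\<lambda>x y z. R * octic_x K x y z", OF c[OF has_deriv_octic_xx[where K = K]]]
    partial_deriv_scaled(2)[where F = "\<lambda>x y z. R * octic_x K x y z", OF c[OF has_deriv_octic_xy[where K = K]]]
    partial_deriv_scaled(3)[where F = "\<lambda>x y z. R * octic_x K x y z", OF c[OF has_deriv_octic_xz[where K = K]]]
    partial_deriv_scaled(1)[where F = "\<lambda>x y z. R * octic_x K y x z", OF c[OF has_deriv_octic_xy[where K = K]]]
    partial_deriv_scaled(2)[where F = "\<lambda>x y z. R * octic_x K y x z", OF c[OF has_deriv_octic_xx[where K = K]]]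
    partial_deriv_scaled(3)[where F = "\<lambda>x y z. R * octic_x K y x z", OF c[OF has_deriv_octic_xz[where K = K]]]
    partial_deriv_scaled(1)[where F = octic_z, OF has_deriv_octic_zx]
    partial_deriv_scaled(2)[where F = octic_z, OF has_deriv_octic_zy]
    partial_deriv_scaled(3)[where F = octic_z, OF has_deriv_octic_zz]
  show ?thesis
    by (simp add: hessian_def inner_vec_def matrix_vector_mult_def sum_3 fx fy fz d
        octic_form_def stretch_def xy algebra_simps power2_eq_square)
qed

section \<open>Positive definiteness of the Hessian for a suitable \<open>K\<close>\<close>

text \<open>Times \<open>x^2 + y^2\<close>, Robinson's form is a sum of three squares, and on the
  axis \<open>x = y = 0\<close> it is \<open>z^6\<close>. The term
  \<open>(x^6 + y^6 + z^6) / 100\<close> makes the inequality strict.\<close>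

lemma sextic_pos:
  assumes "x \<noteq> 0 \<or> y \<noteq> 0 \<or> z \<noteq> 0"
  shows "sextic x y z > 0"
proof -
  define robinson where "robinson = x^6 + y^6 + z^6 - x^4 * y^2 - x^2 * y^4 - z^2 * (x^4 + y^4)
    - z^4 * (x^2 + y^2) + 3 * x^2 * y^2 * z^2"
  have eq: "sextic x y z = robinson + 2 * (x * (x^2 - z^2))^2 + 2 * (y * (y^2 - z^2))^2
      + (x^6 + y^6 + z^6) / 100"
    by (simp add: sextic_def robinson_def field_simps eval_nat_numeral)
  have "(x^2 + y^2) * robinson = (x^4 - y^4 - x^2 * z^2 + y^2 * z^2)^2
      + (y * z * (y^2 - z^2))^2 + (x * z * (x^2 - z^2))^2"
    by (simp add: robinson_def field_simps eval_nat_numeral)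
  then have prod: "(x^2 + y^2) * robinson \<ge> 0"
    by simp
  have "robinson \<ge> 0"
  proof (cases "x = 0 \<and> y = 0")
    case True
    then show ?thesis by (simp add: robinson_def)
  next
    case False
    then have "x^2 + y^2 > 0"
      by (simp add: sum_power2_gt_zero_iff)
    with prod show ?thesis
      by (simp add: zero_le_mult_iff)
  qed
  moreover have "x^6 + y^6 + z^6 > 0"
    using assms zero_le_even_power[of 6 x] zero_le_even_power[of 6 y] zero_le_even_power[of 6 z]
    by (smt (verit) even_numeral power_eq_0_iff)
  ultimately show ?thesis
    unfolding eq by (smt (verit) zero_le_power2 divide_pos_pos)
qed

text \<open>The Hessian quadratic form of \<open>(x\<^sup>2 + y\<^sup>2)\<^sup>4\<close>.\<close>
definition radial_form :: "real^3 \<Rightarrow> real^3 \<Rightarrow> real" where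
  "radial_form x y = 8 * ((x$1)^2 + (x$2)^2)^3 * ((y$1)^2 + (y$2)^2)
     + 48 * ((x$1)^2 + (x$2)^2)^2 * (x$1 * y$1 + x$2 * y$2)^2"

lemma octic_form_split: "octic_form K x y = octic_form 0 x y + K * radial_form x y"
  by (simp add: octic_form_def radial_form_def octic_xx_def octic_xy_def algebra_simps power2_eq_square)

text \<open>The vanishing forces \<open>x\<close> or \<open>y\<close> onto the third axis. If
  \<open>x\<close> lies there, the Hessian is diagonal, positive because \<open>sextic\<close> has
  positive coefficients at \<open>z^4 x^2\<close> and \<open>z^4 y^2\<close>; if \<open>y\<close>
  does, only the \<open>zz\<close> entry contributes.\<close>

lemma octic_form_pos_of_radial_eq_0:
  assumes "x \<noteq> 0" "y \<noteq> 0" "radial_form x y = 0"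
  shows "octic_form 0 x y > 0"
proof -
  have nz: "v$1 \<noteq> 0 \<or> v$2 \<noteq> 0 \<or> v$3 \<noteq> 0" if "v \<noteq> 0" for v :: "real^3"
    using that by (auto simp: vec_eq_iff forall_3)
  have "8 * ((x$1)^2 + (x$2)^2)^3 * ((y$1)^2 + (y$2)^2) = 0"
    using assms(3) unfolding radial_form_def
    by (smt (verit) zero_le_power2 mult_nonneg_nonneg zero_le_power)
  then consider "x$1 = 0" "x$2 = 0" | "y$1 = 0" "y$2 = 0"
    by (auto simp: sum_power2_eq_zero_iff)
  then show ?thesis
  proof cases
    case 1
    then have z: "x$3 \<noteq> 0" using nz[OF assms(1)] by simp
    have "octic_form 0 x y = (x$3)^6 * (((y$1)^2 + (y$2)^2) / 15 + 101/100 * (y$3)^2)"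
      using 1 by (simp add: octic_form_def octic_xx_def octic_xy_def octic_xz_def sextic_def field_simps)
    moreover have "((y$1)^2 + (y$2)^2) / 15 + 101/100 * (y$3)^2 > 0"
    proof -
      have "(y$1)^2 + (y$2)^2 + (y$3)^2 > 0"
        using nz[OF assms(2)] by (smt (verit) zero_less_power2 zero_le_power2)
      then show ?thesis
        using zero_le_power2[of "y$1"] zero_le_power2[of "y$2"] zero_le_power2[of "y$3"]
        unfolding add_divide_distrib by linarith
    qed
    ultimately show ?thesis using z by (simp add: zero_less_mult_iff)
  next
    case 2
    then have "y$3 \<noteq> 0" using nz[OF assms(2)] by simp
    with 2 show ?thesis
      using sextic_pos[OF nz[OF assms(1)]] by (simp add: octic_form_def)
  qed
qed

text \<open>Where \<open>A\<close> is positive, any \<open>K >= 0\<close> works. The rest of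
  \<open>S\<close> is compact, so \<open>B\<close> has a positive minimum there, which a large
  \<open>K\<close> plays off against the minimum of \<open>A\<close>.\<close>

lemma compact_pos_add_mult:
  fixes A B :: "'a::topological_space \<Rightarrow> real"
  assumes "compact S" "continuous_on S A" "continuous_on S B"
    and nn: "\<And>s. s \<in> S \<Longrightarrow> B s \<ge> 0"
    and pos: "\<And>s. s \<in> S \<Longrightarrow> B s = 0 \<Longrightarrow> A s > 0"
  obtains K where "\<And>s. s \<in> S \<Longrightarrow> A s + K * B s > 0"
proof -
  define T where "T = S \<inter> {s \<in> S. A s \<le> 0}"
  have "closedin (top_of_set S) {s \<in> S. A s \<le> 0}"
    using continuous_closedin_preimage[OF assms(2) closed_atMost[of 0]]
    by (simp add: vimage_def Int_def)
  then obtain C where C: "closed C" "{s \<in> S. A s \<le> 0} = S \<inter> C"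
    by (auto simp: closedin_closed)
  then have T: "compact T"
    using compact_Int_closed[OF assms(1) C(1)] by (auto simp: T_def)
  have TS: "T \<subseteq> S" by (auto simp: T_def)
  show thesis
  proof (cases "T = {}")
    case True
    then show ?thesis
      by (intro that[of 0]) (force simp: T_def)
  next
    case False
    obtain a where a: "a \<in> T" "\<And>s. s \<in> T \<Longrightarrow> A a \<le> A s"
      using continuous_attains_inf[OF T False continuous_on_subset[OF assms(2) TS]] by blast
    obtain b where b: "b \<in> T" "\<And>s. s \<in> T \<Longrightarrow> B b \<le> B s"
      using continuous_attains_inf[OF T False continuous_on_subset[OF assms(3) TS]] by blast
    have Bb: "B b > 0"
      using b(1) nn[of b] pos[of b] by (force simp: T_def)
    have Aa: "A a \<le> 0" using a(1) by (simp add: T_def)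
    \<comment> \<open>This choice makes \<open>A s + K * B s\<close> at least 1 on
      \<open>T\<close>.\<close>
    define K where "K = (1 - A a) / B b"
    have K: "K > 0" using Bb Aa by (simp add: K_def)
    show ?thesis
    proof (rule that[of K])
      fix s assume s: "s \<in> S"
      show "A s + K * B s > 0"
      proof (cases "s \<in> T")
        case True
        have "K * B s \<ge> K * B b" using K b(2)[OF True] by simp
        also have "K * B b = 1 - A a" using Bb by (simp add: K_def)
        finally show ?thesis using a(2)[OF True] by linarith
      next
        case False
        then show ?thesis using s nn[OF s] K
          by (auto simp: T_def intro!: add_pos_nonneg)
      qed
    qed
  qed
qed

lemma octic_form_scale: "octic_form K (s *\<^sub>R x) (t *\<^sub>R y) = s^6 * t^2 * octic_form K x y"
proof -
  have "octic_xx K (s * a) (s * b) (s * c) = s^6 * octic_xx K a b c" for a b c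
    by (simp add: octic_xx_def field_simps eval_nat_numeral)
  moreover have "octic_xy K (s * a) (s * b) (s * c) = s^6 * octic_xy K a b c" for a b c
    by (simp add: octic_xy_def field_simps eval_nat_numeral)
  moreover have "octic_xz (s * a) (s * b) (s * c) = s^6 * octic_xz a b c" for a b c
    by (simp add: octic_xz_def field_simps eval_nat_numeral)
  moreover have "sextic (s * a) (s * b) (s * c) = s^6 * sextic a b c" for a b c
    by (simp add: sextic_def field_simps eval_nat_numeral)
  ultimately show ?thesis
    by (simp add: octic_form_def) (simp add: algebra_simps power2_eq_square)
qed

text \<open>The form is homogeneous in each argument and affine in \<open>K\<close>, so the
  compactness argument on a product of unit spheres suffices.\<close>

lemma octic_form_pos:
  obtains K where "\<And>x y. x \<noteq> 0 \<Longrightarrow> y \<noteq> 0 \<Longrightarrow> octic_form K x y > 0"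
proof -
  let ?S = "sphere (0::real^3) 1 \<times> sphere (0::real^3) 1"
  have cA: "continuous_on ?S (\<lambda>(x, y). octic_form 0 x y)"
    unfolding octic_form_def octic_xx_def octic_xy_def octic_xz_def sextic_def case_prod_beta
    by (intro continuous_intros) auto
  have cB: "continuous_on ?S (\<lambda>(x, y). radial_form x y)"
    unfolding radial_form_def case_prod_beta by (intro continuous_intros)
  have nn: "(case s of (x, y) \<Rightarrow> radial_form x y) \<ge> 0" for s
    by (auto simp: radial_form_def split: prod.splits)
  have pos: "(case s of (x, y) \<Rightarrow> octic_form 0 x y) > 0"
    if s: "s \<in> ?S" "(case s of (x, y) \<Rightarrow> radial_form x y) = 0" for s
  proof -
    obtain x y where [simp]: "s = (x, y)" by fastforce
    show ?thesis using s octic_form_pos_of_radial_eq_0[of x y] by force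
  qed
  have cpt: "compact ?S" by (intro compact_Times compact_sphere)
  obtain K where K: "\<And>s. s \<in> ?S \<Longrightarrow>
      (case s of (x, y) \<Rightarrow> octic_form 0 x y) + K * (case s of (x, y) \<Rightarrow> radial_form x y) > 0"
    using compact_pos_add_mult[OF cpt cA cB nn pos] by metis
  show thesis
  proof (rule that[of K])
    fix x y :: "real^3" assume "x \<noteq> 0" "y \<noteq> 0"
    then have "octic_form K (inverse (norm x) *\<^sub>R x) (inverse (norm y) *\<^sub>R y) > 0"
      using K[of "(inverse (norm x) *\<^sub>R x, inverse (norm y) *\<^sub>R y)"]
      by (simp add: octic_form_split[of K])
    then have "inverse (norm x) ^ 6 * (inverse (norm y))\<^sup>2 * octic_form K x y > 0"
      by (simp only: octic_form_scale)
    moreover have "inverse (norm x) ^ 6 * (inverse (norm y))\<^sup>2 > 0"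
      using \<open>x \<noteq> 0\<close> \<open>y \<noteq> 0\<close> by simp
    ultimately show "octic_form K x y > 0"
      by (meson zero_less_mult_pos)
  qed
qed

lemma is_form_scaled_octic: "is_form 8 (scaled_octic K R)"
proof -
  have coord: "polyfun (\<lambda>x::real^3. x $ i)" for i
    using polyfun.coord[of "axis i 1 :: real^3"] by (simp add: cart_eq_inner_axis axis_in_Basis_iff)
  have pow: "polyfun (\<lambda>x. p x ^ n)" if "polyfun p" for p :: "real^3 \<Rightarrow> real" and n
    by (induction n) (auto intro: polyfun.intros that)
  have cmult: "polyfun (\<lambda>x. p x / c)" if "polyfun p" for p :: "real^3 \<Rightarrow> real" and c
    using polyfun.mult[OF that polyfun.const[of "1 / c"]] by simp
  have diff: "polyfun (\<lambda>x. p x - q x)" if "polyfun p" "polyfun q" for p q :: "real^3 \<Rightarrow> real"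
    using polyfun.add[OF that(1) polyfun.mult[OF polyfun.const[of "-1"] that(2)]] by simp
  have "polyfun (scaled_octic K R)"
    unfolding scaled_octic_def octic_def
    by (intro polyfun.add polyfun.mult polyfun.const coord pow cmult diff)
  moreover have "scaled_octic K R (t *\<^sub>R x) = t^8 * scaled_octic K R x" for t x
    by (simp add: scaled_octic_def octic_def field_simps eval_nat_numeral)
  ultimately show ?thesis by (simp add: is_form_def)
qed

section \<open>Grid differences of polynomials below a sextic\<close>

text \<open>Replaces a decomposition into an unknown number of squares by one polynomial, to which
  finite differences can be applied.\<close>

lemma sos_touching_square:
  assumes "sos P"
  obtains q where "polyfun q" "\<And>z. (q z)^2 \<le> P z" "(q z0)^2 = P z0"
proof -
  have "\<exists>q. polyfun q \<and> (\<forall>z. (q z)^2 \<le> (\<Sum>q\<leftarrow>qs. (q z)^2)) \<and> (q z0)^2 = (\<Sum>q\<leftarrow>qs. (q z0)^2)"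
    if "\<forall>q\<in>set qs. polyfun q" for qs :: "('a \<Rightarrow> real) list"
    using that
  proof (induction qs)
    case Nil
    show ?case by (intro exI[of _ "\<lambda>_. 0"]) (auto intro: polyfun.const)
  next
    case (Cons p qs)
    then obtain q where q: "polyfun q" "\<And>z. (q z)^2 \<le> (\<Sum>q\<leftarrow>qs. (q z)^2)"
        "(q z0)^2 = (\<Sum>q\<leftarrow>qs. (q z0)^2)"
      by auto
    have p: "polyfun p" using Cons.prems by simp
    txt \<open>Among the \<open>c p + s q\<close> with \<open>c\<^sup>2 + s\<^sup>2 = 1\<close>, all below the envelope, choose one that touches it at \<open>z0\<close>.\<close>
    obtain c s where cs: "c^2 + s^2 = 1" "(c * p z0 + s * q z0)^2 = (p z0)^2 + (q z0)^2"
    proof (cases "p z0 = 0 \<and> q z0 = 0")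
      case True
      then show ?thesis using that[of 1 0] by simp
    next
      case False
      define N where "N = sqrt ((p z0)^2 + (q z0)^2)"
      have N: "N^2 = (p z0)^2 + (q z0)^2" by (simp add: N_def)
      have "N^2 > 0" using False by (simp add: N sum_power2_gt_zero_iff)
      then have N0: "N \<noteq> 0" by auto
      have "p z0 / N * p z0 + q z0 / N * q z0 = N"
        using N N0 by (simp add: field_simps power2_eq_square)
      moreover have "(p z0 / N)^2 + (q z0 / N)^2 = 1"
        using N0 by (simp add: power_divide add_divide_distrib[symmetric] N[symmetric])
      ultimately show ?thesis using that[of "p z0 / N" "q z0 / N"] N by simp
    qed
    have "(c * p z + s * q z)^2 \<le> (p z)^2 + (q z)^2" for z
    proof -
      have "(c * p z + s * q z)^2 + (s * p z - c * q z)^2 = (c^2 + s^2) * ((p z)^2 + (q z)^2)"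
        by (simp add: power2_eq_square algebra_simps)
      then show ?thesis by (metis cs(1) mult_1 le_add_same_cancel1 zero_le_power2)
    qed
    then have "(c * p z + s * q z)^2 \<le> (\<Sum>q\<leftarrow>p # qs. (q z)^2)" for z
      using q(2)[of z] by (smt (verit) list.simps(9) sum_list.Cons)
    then show ?case
      using cs(2) q(3) by (intro exI[of _ "\<lambda>z. c * p z + s * q z"])
        (auto intro!: polyfun.intros p q(1))
  qed
  then show thesis using assms that unfolding sos_def by metis
qed

text \<open>Bivariate polynomials are encoded as \<^typ>\<open>real poly poly\<close>, the inner variable being \<open>u\<close>.\<close>
lemma polyfun_on_plane:
  fixes q :: "'a::euclidean_space \<Rightarrow> real"
  assumes "polyfun q"
  obtains P :: "real poly poly"
  where "\<And>u v. q (a + u *\<^sub>R b + v *\<^sub>R c) = poly (poly P [:v:]) u"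
proof -
  have "\<exists>P :: real poly poly. \<forall>u v. q (a + u *\<^sub>R b + v *\<^sub>R c) = poly (poly P [:v:]) u"
    using assms
  proof induction
    case (const c)
    show ?case by (intro exI[of _ "[:[:c:]:]"]) simp
  next
    case (coord i)
    show ?case
      by (intro exI[of _ "[:[:a \<bullet> i, b \<bullet> i:], [:c \<bullet> i:]:]"])
        (simp add: inner_add_left algebra_simps)
  next
    case (add p q)
    then obtain P Q :: "real poly poly" where
      "\<And>u v. p (a + u *\<^sub>R b + v *\<^sub>R c) = poly (poly P [:v:]) u"
      "\<And>u v. q (a + u *\<^sub>R b + v *\<^sub>R c) = poly (poly Q [:v:]) u" by blast
    then show ?case by (intro exI[of _ "P + Q"]) simp
  next
    case (mult p q)
    then obtain P Q :: "real poly poly" where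
      "\<And>u v. p (a + u *\<^sub>R b + v *\<^sub>R c) = poly (poly P [:v:]) u"
      "\<And>u v. q (a + u *\<^sub>R b + v *\<^sub>R c) = poly (poly Q [:v:]) u" by blast
    then show ?case by (intro exI[of _ "P * Q"]) simp
  qed
  then show thesis using that by blast
qed

section \<open>Mixed second differences and polynomial growth\<close>

text \<open>The second central difference in \<open>u\<close> composed with the one in
  \<open>v\<close>, at the origin with step \<open>s\<close>: weights \<open>(1, -2, 1)\<close> in
  each direction.\<close>

definition grid_diff :: "(real \<Rightarrow> real \<Rightarrow> real) \<Rightarrow> real \<Rightarrow> real" where
  "grid_diff g s = g s s + g s (-s) + g (-s) s + g (-s) (-s)
     - 2 * (g s 0 + g (-s) 0 + g 0 s + g 0 (-s)) + 4 * g 0 0"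

text \<open>On a monomial the difference factors over the variables, and second differences kill the
  exponents 0 and 1, so each surviving monomial is divisible by \<open>u^2 v^2\<close>.\<close>

lemma grid_diff_poly:
  fixes P :: "real poly poly"
  obtains \<psi> where "\<And>s. grid_diff (\<lambda>u v. poly (poly P [:v:]) u) s = s^4 * poly \<psi> s"
proof -
  \<comment> \<open>The second difference of \<open>t^i\<close> at 0 is this number times
    \<open>s^i\<close>: 0 if \<open>i\<close> is 0 or odd, otherwise 2.\<close>
  define \<delta> :: "nat \<Rightarrow> real" where "\<delta> i = 1 + (-1)^i - 2 * 0^i" for i
  define m where "m i = degree (coeff P i)" for i
  define c where "c i j = coeff (coeff P i) j" for i j
  have \<delta>: "s^i + (-s)^i - 2 * 0^i = \<delta> i * s^i" for i and s :: real
    by (cases "even i") (auto simp: \<delta>_def algebra_simps power_0_left)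
  have "\<delta> 1 = 0" "\<delta> 0 = 0" by (auto simp: \<delta>_def)
  then have \<delta>0: "\<delta> i = 0" if "i < 2" for i
    using that by (metis One_nat_def less_2_cases)
  \<comment> \<open>Truncation in \<open>i + j - 4\<close> is harmless: the coefficient is 0 unless
    both exponents are at least 2.\<close>
  have mon: "grid_diff (\<lambda>u v. u^j * v^i) s = s^4 * poly (monom (\<delta> j * \<delta> i) (i + j - 4)) s" for i j s
  proof -
    have "grid_diff (\<lambda>u v. u^j * v^i) s =
        (s^j + (-s)^j - 2 * 0^j) * (s^i + (-s)^i - 2 * 0^i)"
      by (simp add: grid_diff_def algebra_simps)
    also have "\<dots> = \<delta> j * \<delta> i * s^(i + j)"
      by (simp add: \<delta> power_add)
    also have "\<dots> = s^4 * poly (monom (\<delta> j * \<delta> i) (i + j - 4)) s"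
    proof (cases "i < 2 \<or> j < 2")
      case True
      then show ?thesis using \<delta>0 by auto
    next
      case False
      then have "s^(i + j) = s^4 * s^(i + j - 4)" by (simp flip: power_add)
      then show ?thesis by (simp add: poly_monom)
    qed
    finally show ?thesis .
  qed
  have "poly (poly P [:v:]) u = (\<Sum>i\<le>degree P. \<Sum>j\<le>m i. c i j * (u^j * v^i))" for u v
    by (simp add: poly_altdef[of P] poly_sum poly_power poly_altdef[of "coeff P _"]
        sum_distrib_right m_def c_def mult.assoc)
  then have "grid_diff (\<lambda>u v. poly (poly P [:v:]) u) s =
      (\<Sum>i\<le>degree P. \<Sum>j\<le>m i. c i j * grid_diff (\<lambda>u v. u^j * v^i) s)" for s
    by (simp add: grid_diff_def sum.distrib sum_subtractf sum_distrib_left algebra_simps)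
  also have "\<dots> s = s^4 * poly (\<Sum>i\<le>degree P. \<Sum>j\<le>m i. smult (c i j)
      (monom (\<delta> j * \<delta> i) (i + j - 4))) s" for s
    by (simp add: mon poly_sum sum_distrib_left algebra_simps)
  finally show thesis by (rule that)
qed

text \<open>Carries bounds from nodes at or beyond 1, where growth estimates apply, back into
  \<open>[0, 1]\<close>. The constant depends only on the degree bound; the induction divides out
  the last node.\<close>

lemma poly_bound_extrapolate:
  "\<exists>C>0. \<forall>(p::real poly) M. degree p \<le> d \<longrightarrow> (\<forall>k\<in>{1..Suc d}. \<bar>poly p (real k)\<bar> \<le> M) \<longrightarrow>
     (\<forall>s\<in>{0..1}. \<bar>poly p s\<bar> \<le> C * M)"
proof (induction d)
  case 0
  show ?case
  proof (intro exI[of _ 1] conjI allI impI ballI)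
    fix p :: "real poly" and M s :: real
    assume "degree p \<le> 0" "\<forall>k\<in>{1..Suc 0}. \<bar>poly p (real k)\<bar> \<le> M"
    then show "\<bar>poly p s\<bar> \<le> 1 * M"
      by (auto elim!: degree_eq_zeroE)
  qed simp
next
  case (Suc d)
  then obtain C where C: "C > 0" and IH: "\<And>(p::real poly) M s. degree p \<le> d \<Longrightarrow>
      (\<forall>k\<in>{1..Suc d}. \<bar>poly p (real k)\<bar> \<le> M) \<Longrightarrow> s \<in> {0..1} \<Longrightarrow> \<bar>poly p s\<bar> \<le> C * M"
    by blast
  define a where "a = real (Suc (Suc d))"
  show ?case
  proof (intro exI[of _ "1 + a * (C * 2)"] conjI allI impI ballI)
    show "1 + a * (C * 2) > 0" using C by (simp add: a_def add_pos_pos)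
    fix p :: "real poly" and M s :: real
    assume deg: "degree p \<le> Suc d" and M: "\<forall>k\<in>{1..Suc (Suc d)}. \<bar>poly p (real k)\<bar> \<le> M"
      and s: "s \<in> {0..1}"
    \<comment> \<open>The last node \<open>a\<close> is at distance at least 1 from the others, so
      this quotient of \<open>p - p(a)\<close> by \<open>t - a\<close> is at most
      \<open>2 * M\<close> at them.\<close>
    define q where "q = synthetic_div p a"
    have p: "poly p t = (t - a) * poly q t + poly p a" for t
      using arg_cong[OF synthetic_div_correct'[of a p], of "\<lambda>p. poly p t"]
      by (simp add: q_def algebra_simps)
    have pa: "\<bar>poly p a\<bar> \<le> M" using M[rule_format, of "Suc (Suc d)"] unfolding a_def by simp
    have "degree q \<le> d" using deg by (simp add: q_def degree_synthetic_div)
    moreover have "\<bar>poly q (real k)\<bar> \<le> 2 * M" if k: "k \<in> {1..Suc d}" for k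
    proof -
      have "\<bar>poly q (real k)\<bar> = 1 * \<bar>poly q (real k)\<bar>" by simp
      also have "\<dots> \<le> \<bar>real k - a\<bar> * \<bar>poly q (real k)\<bar>"
        using k by (intro mult_right_mono) (auto simp: a_def)
      also have "\<dots> = \<bar>poly p (real k) - poly p a\<bar>"
        using p[of "real k"] by (simp add: abs_mult)
      also have "\<dots> \<le> 2 * M" using M[rule_format, of k] k pa by simp
      finally show ?thesis .
    qed
    ultimately have "\<bar>poly q s\<bar> \<le> C * (2 * M)" using IH s by blast
    moreover have "\<bar>s - a\<bar> \<le> a" using s by (auto simp: a_def)
    ultimately have "\<bar>s - a\<bar> * \<bar>poly q s\<bar> \<le> a * (C * (2 * M))"
      by (intro mult_mono) (auto simp: a_def)
    then have "\<bar>poly p s\<bar> \<le> a * (C * (2 * M)) + M"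
      using pa abs_triangle_ineq[of "(s - a) * poly q s" "poly p a"]
      unfolding p[of s] abs_mult by linarith
    then show "\<bar>poly p s\<bar> \<le> (1 + a * (C * 2)) * M"
      by (simp add: algebra_simps)
  qed
qed

text \<open>Otherwise \<open>p(t) / t^(degree p)\<close> would tend both to the leading coefficient
  and, at rate \<open>M / t\<close>, to 0.\<close>

lemma degree_le_of_growth:
  fixes p :: "real poly"
  assumes "\<And>t. t \<ge> 1 \<Longrightarrow> \<bar>poly p t\<bar> \<le> M * t^n"
  shows "degree p \<le> n"
proof (rule ccontr)
  assume "\<not> degree p \<le> n"
  then have n: "degree p \<ge> Suc n" by simp
  have M: "M \<ge> 0" using assms[of 1] by simp
  have "((\<lambda>t. poly p t / t^degree p) \<longlongrightarrow> lead_coeff p) at_top"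
    using poly_divide_tendsto_aux[of p] at_top_le_at_infinity by (rule tendsto_mono[rotated])
  moreover have "((\<lambda>t. poly p t / t^degree p) \<longlongrightarrow> 0) at_top"
  proof (rule Lim_null_comparison)
    show "\<forall>\<^sub>F t in at_top. norm (poly p t / t^degree p) \<le> M / t"
      using eventually_ge_at_top[of 1]
    proof eventually_elim
      case (elim t)
      have "t^Suc n \<le> t^degree p" using elim n by (intro power_increasing) auto
      then have "M * t^Suc n \<le> M * t^degree p" using M by (rule mult_left_mono)
      moreover have "\<bar>poly p t\<bar> * t \<le> M * t^Suc n"
        using mult_right_mono[OF assms[OF elim], of t] elim by (simp add: mult_ac)
      ultimately have "\<bar>poly p t\<bar> * t \<le> M * t^degree p" by linarith
      then show ?case using elim by (simp add: abs_divide power_abs field_simps)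
    qed
    show "((\<lambda>t. M / t) \<longlongrightarrow> 0) at_top"
      by (intro tendsto_divide_0[OF tendsto_const] filterlim_at_top_imp_at_infinity filterlim_ident)
  qed
  ultimately have "lead_coeff p = 0" by (intro tendsto_unique[OF _ _ _]) auto
  then show False using n by simp
qed

text \<open>After division by \<open>s^4\<close>, growth limits the degree and the values at
  \<open>1, ..., r + 1\<close>, and extrapolation reaches \<open>[0, 1]\<close>. The constant serves
  all \<open>P\<close> and \<open>M\<close>, so it can be fixed before \<open>R\<close>.\<close>

lemma grid_diff_bound:
  obtains C where "C > 0" "\<And>(P::real poly poly) M s. s \<in> {0..1} \<Longrightarrow>
    (\<And>t. t \<ge> 1 \<Longrightarrow> \<bar>grid_diff (\<lambda>u v. poly (poly P [:v:]) u) t\<bar> \<le> M * t^(r + 3)) \<Longrightarrow>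
    \<bar>grid_diff (\<lambda>u v. poly (poly P [:v:]) u) s\<bar> \<le> C * M * s^4"
proof -
  obtain C where C: "C > 0" "\<And>(p::real poly) M s. degree p \<le> r \<Longrightarrow>
      (\<forall>k\<in>{1..Suc r}. \<bar>poly p (real k)\<bar> \<le> M) \<Longrightarrow> s \<in> {0..1} \<Longrightarrow> \<bar>poly p s\<bar> \<le> C * M"
    using poly_bound_extrapolate[of r] by blast
  define K where "K = real (Suc r)^(r + 3)"
  show thesis
  proof (rule that[of "C * K"])
    show "C * K > 0" using C by (simp add: K_def)
    fix P :: "real poly poly" and M s :: real
    let ?g = "\<lambda>u v. poly (poly P [:v:]) u"
    assume s: "s \<in> {0..1}" and bnd: "\<And>t. t \<ge> 1 \<Longrightarrow> \<bar>grid_diff ?g t\<bar> \<le> M * t^(r + 3)"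
    obtain p where p: "\<And>s. grid_diff ?g s = s^4 * poly p s" using grid_diff_poly[of P] by blast
    have M: "M \<ge> 0" using bnd[of 1] by simp
    have "degree (monom 1 4 * p) \<le> r + 3"
      by (rule degree_le_of_growth[of _ M]) (use bnd in \<open>simp add: p poly_monom\<close>)
    then have "degree p \<le> r"
      by (cases "p = 0") (auto simp: degree_mult_eq degree_monom_eq monom_eq_0_iff)
    moreover have "\<bar>poly p (real k)\<bar> \<le> K * M" if k: "k \<in> {1..Suc r}" for k
    proof -
      have "\<bar>poly p (real k)\<bar> = 1 * \<bar>poly p (real k)\<bar>" by simp
      also have "\<dots> \<le> \<bar>real k^4\<bar> * \<bar>poly p (real k)\<bar>"
        using k by (intro mult_right_mono) (auto simp: one_le_power)
      also have "\<dots> \<le> M * real k^(r + 3)" using bnd[of "real k"] k by (simp add: p abs_mult)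
      also have "\<dots> \<le> M * K"
        using k M unfolding K_def by (intro mult_left_mono power_mono) auto
      finally show ?thesis by (simp add: mult.commute)
    qed
    ultimately have "\<bar>poly p s\<bar> \<le> C * (K * M)" using C(2) s by blast
    then have "s^4 * \<bar>poly p s\<bar> \<le> s^4 * (C * (K * M))" by (rule mult_left_mono) simp
    then show "\<bar>grid_diff ?g s\<bar> \<le> C * K * M * s^4"
      by (simp add: p abs_mult mult_ac)
  qed
qed

section \<open>Choice of \<open>R\<close> and the contradiction on the grid\<close>

text \<open>Without the negative terms the coefficients sum to 12.03; rounding up to the square 16
  gives a clean root later.\<close>

lemma sextic_le:
  assumes "x^2 \<le> T" "y^2 \<le> T" "T \<ge> 1"
  shows "sextic x y 1 \<le> 16 * T^3"
proof -
  define a where "a = x^2"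
  define b where "b = y^2"
  have ab: "0 \<le> a" "0 \<le> b" "a \<le> T" "b \<le> T" using assms by (auto simp: a_def b_def)
  have "a^3 \<le> T^3" "b^3 \<le> T^3" using ab by (auto intro: power_mono)
  moreover have "T \<le> T^3" "T^2 \<le> T^3" "1 \<le> T^3"
    using assms(3) power_increasing[of 1 3 T] power_increasing[of 2 3 T] by (auto simp: one_le_power)
  moreover have "a * b \<le> T^2" using ab assms(3) by (simp add: power2_eq_square mult_mono)
  moreover have "0 \<le> a^2" "0 \<le> b^2" "0 \<le> a^2 * b" "0 \<le> a * b^2" using ab by auto
  moreover have "sextic x y 1 = 1 + (a + b) + (3 * (a * b) - 5 * a^2 - 5 * b^2)
      + (3 * a^3 + 3 * b^3 - a^2 * b - a * b^2) + (a^3 + b^3 + 1) / 100"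
    by (simp add: sextic_def a_def b_def flip: power_mult)
  ultimately show ?thesis using ab by argo
qed

text \<open>The absolute weights sum to \<open>4 * 1 + 4 * 2 + 4 = 16\<close>.\<close>

lemma abs_grid_diff_le:
  assumes "\<And>u v. u^2 \<le> s^2 \<Longrightarrow> v^2 \<le> s^2 \<Longrightarrow> \<bar>g u v\<bar> \<le> B"
  shows "\<bar>grid_diff g s\<bar> \<le> 16 * B"
proof -
  have "\<bar>g s s\<bar> \<le> B" "\<bar>g s (-s)\<bar> \<le> B" "\<bar>g (-s) s\<bar> \<le> B" "\<bar>g (-s) (-s)\<bar> \<le> B"
    "\<bar>g s 0\<bar> \<le> B" "\<bar>g (-s) 0\<bar> \<le> B" "\<bar>g 0 s\<bar> \<le> B" "\<bar>g 0 (-s)\<bar> \<le> B" "\<bar>g 0 0\<bar> \<le> B"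
    by (simp_all add: assms)
  note this[THEN abs_le_D1] this[THEN abs_le_D2]
  then show ?thesis
    unfolding grid_diff_def distrib_left by (intro abs_leI) linarith+
qed

lemma not_touching_square_sextic:
  obtains R where "R > 0" "\<And>P :: real poly poly.
    (\<And>u v. (poly (poly P [:v:]) u)^2 \<le> sextic (R * u) (R * v) 1 * (u^2 + v^2 + 1)^r) \<Longrightarrow>
    (poly (poly P 0) 0)^2 \<noteq> sextic 0 0 1"
proof -
  obtain C where C: "C > 0" "\<And>(P::real poly poly) M s. s \<in> {0..1} \<Longrightarrow>
    (\<And>t. t \<ge> 1 \<Longrightarrow> \<bar>grid_diff (\<lambda>u v. poly (poly P [:v:]) u) t\<bar> \<le> M * t^(r + 3)) \<Longrightarrow>
    \<bar>grid_diff (\<lambda>u v. poly (poly P [:v:]) u) s\<bar> \<le> C * M * s^4"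
    using grid_diff_bound[of r] by metis
  \<comment> \<open>This quantity bounds the weight \<open>(u^2 + v^2 + 1)^r\<close> on the grid of
    step \<open>1 / R\<close>; once below 2, it costs only a factor 2.\<close>
  have "((\<lambda>R::real. (2 * (1 / R)^2 + 1)^r) \<longlongrightarrow> (2 * 0^2 + 1)^r) at_top"
    by (intro tendsto_power tendsto_add tendsto_mult tendsto_const tendsto_divide_0[OF tendsto_const]
        filterlim_at_top_imp_at_infinity filterlim_ident)
  then have "\<forall>\<^sub>F R in at_top. (2 * (1 / R)^2 + 1 :: real)^r < 2"
    by (rule order_tendstoD) simp
  \<comment> \<open>The last condition makes \<open>C * (64 * 3^r * R^3) * (1 / R)^4\<close> at most
    1.\<close>
  then have "\<forall>\<^sub>F R in at_top. (2 * (1 / R)^2 + 1 :: real)^r < 2 \<and> R \<ge> 1 \<and> R \<ge> C * (64 * 3^r)"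
    by (intro eventually_conj eventually_ge_at_top)
  then obtain R :: real where R: "(2 * (1 / R)^2 + 1)^r < 2" "R \<ge> 1" "R \<ge> C * (64 * 3^r)"
    by (metis (no_types, lifting) eventually_happens trivial_limit_at_top_linorder)
  define s where "s = 1 / R"
  have s: "s \<in> {0..1}" "R * s = 1" "s > 0" using R(2) by (auto simp: s_def)
  show thesis
  proof (rule that[of R])
    show "R > 0" using R by simp
    fix P :: "real poly poly"
    define g where "g u v = poly (poly P [:v:]) u" for u v
    assume "\<And>u v. (poly (poly P [:v:]) u)^2 \<le> sextic (R * u) (R * v) 1 * (u^2 + v^2 + 1)^r"
    then have g: "(g u v)^2 \<le> sextic (R * u) (R * v) 1 * (u^2 + v^2 + 1)^r" for u v
      by (simp add: g_def)
    show "(poly (poly P 0) 0)^2 \<noteq> sextic 0 0 1"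
    proof
      assume "(poly (poly P 0) 0)^2 = sextic 0 0 1"
      then have "(g 0 0)^2 = 101 / 100"
        by (simp add: g_def sextic_def)
      then have g0: "\<bar>g 0 0\<bar> \<ge> 1"
        using abs_le_square_iff[of 1 "g 0 0"] by simp
      have "\<bar>grid_diff g t\<bar> \<le> (64 * 3^r * R^3) * t^(r + 3)" if t: "t \<ge> 1" for t
      proof -
        have "\<bar>g u v\<bar> \<le> 4 * (R * t)^3 * (3^r * t^r)" if uv: "u^2 \<le> t^2" "v^2 \<le> t^2" for u v
        proof -
          have Rt: "R * t \<ge> 1" using mult_mono[of 1 R 1 t] R(2) t by simp
          have "sextic (R * u) (R * v) 1 \<le> 16 * ((R * t)^2)^3"
            using uv one_le_power[OF Rt, of 2] by (intro sextic_le) (auto simp: power_mult_distrib mult_left_mono)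
          \<comment> \<open>The left side is at most \<open>3 * t^2\<close>; 9 makes the bound the
            square of \<open>3 * t\<close>.\<close>
          moreover have "u^2 + v^2 + 1 \<le> 9 * t^2"
            using uv one_le_power[OF t, of 2] by linarith
          then have "(u^2 + v^2 + 1)^r \<le> (9 * t^2)^r"
            by (rule power_mono) simp
          ultimately have "sextic (R * u) (R * v) 1 * (u^2 + v^2 + 1)^r \<le> 16 * ((R * t)^2)^3 * (9 * t^2)^r"
            by (intro mult_mono) auto
          also have "\<dots> = (4 * (R * t)^3 * (3^r * t^r))^2"
          proof -
            have "(9 * t^2)^r = ((3 * t)^2)^r" by (simp add: power_mult_distrib)
            moreover have "((3 * t)^2)^r = ((3 * t)^r)^2" "((R * t)^2)^3 = ((R * t)^3)^2"
              by (metis power_mult mult.commute)+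
            ultimately show ?thesis by (simp only: power_mult_distrib) simp
          qed
          finally have "(g u v)^2 \<le> (4 * (R * t)^3 * (3^r * t^r))^2" using g[of u v] by linarith
          then show ?thesis using R(2) t by (simp add: abs_le_square_iff[symmetric])
        qed
        then have "\<bar>grid_diff g t\<bar> \<le> 16 * (4 * (R * t)^3 * (3^r * t^r))"
          by (rule abs_grid_diff_le)
        also have "\<dots> = (64 * 3^r * R^3) * t^(r + 3)"
          by (simp add: power_mult_distrib power_add)
        finally show ?thesis .
      qed
      then have "\<bar>grid_diff g s\<bar> \<le> C * (64 * 3^r * R^3) * s^4"
        using C(2)[OF s(1), of P "64 * 3^r * R^3"] unfolding g_def by blast
      also have "\<dots> = C * (64 * 3^r) * (R * s)^3 * s"
        by (simp add: power_mult_distrib eval_nat_numeral)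
      also have "\<dots> \<le> 1"
        using R(3) R(2) s(2) by (simp add: s_def field_simps)
      finally have small: "\<bar>grid_diff g s\<bar> \<le> 1" .
      have bound: "\<bar>g u v\<bar> \<le> e"
        if uv: "u^2 \<le> s^2" "v^2 \<le> s^2" and e: "2 * sextic (R * u) (R * v) 1 \<le> e^2" "e \<ge> 0" for u v e
      proof -
        have "(u^2 + v^2 + 1)^r \<le> (2 * s^2 + 1)^r" using uv by (intro power_mono) auto
        then have "(u^2 + v^2 + 1)^r \<le> 2" using R(1) by (simp add: s_def)
        moreover have "sextic (R * u) (R * v) 1 \<ge> 0"
          using sextic_pos[of "R * u" "R * v" 1] by simp
        ultimately have "sextic (R * u) (R * v) 1 * (u^2 + v^2 + 1)^r \<le> sextic (R * u) (R * v) 1 * 2"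
          by (intro mult_left_mono)
        with g[of u v] e have "(g u v)^2 \<le> e^2" by linarith
        then show ?thesis using e(2) by (simp add: abs_le_square_iff[symmetric])
      qed
      \<comment> \<open>At these eight points Robinson's form and the added squares vanish:
        \<open>sextic\<close> is 2/100 on the edges and 3/100 at the corners, with
        \<open>2 * 2/100 = (1/5)^2\<close> and \<open>2 * 3/100 <= (1/4)^2\<close>.\<close>
      have edges: "\<bar>g s 0\<bar> \<le> 1/5" "\<bar>g (-s) 0\<bar> \<le> 1/5" "\<bar>g 0 s\<bar> \<le> 1/5" "\<bar>g 0 (-s)\<bar> \<le> 1/5"
        by (rule bound; simp add: s(2) sextic_def power2_eq_square)+
      have corners: "\<bar>g s s\<bar> \<le> 1/4" "\<bar>g s (-s)\<bar> \<le> 1/4" "\<bar>g (-s) s\<bar> \<le> 1/4" "\<bar>g (-s) (-s)\<bar> \<le> 1/4"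
        by (rule bound; simp add: s(2) sextic_def power2_eq_square)+
      \<comment> \<open>Here \<open>4 * \<bar>g 0 0\<bar>\<close> is at most
        \<open>1 + 4 * (1/4) + 8 * (1/5) = 36/10\<close>.\<close>
      have "\<bar>g 0 0\<bar> \<le> 9/10"
        using edges[THEN abs_le_D1] edges[THEN abs_le_D2] corners[THEN abs_le_D1]
          corners[THEN abs_le_D2] small[THEN abs_le_D1] small[THEN abs_le_D2]
        unfolding grid_diff_def distrib_left by (intro abs_leI) linarith+
      with g0 show False by simp
    qed
  qed
qed

theorem theorem6:
  fixes r :: nat
  shows "\<exists>f :: real^3 \<Rightarrow> real. is_form 8 f \<and>
           (\<forall>x. x \<noteq> 0 \<longrightarrow> pos_def (hessian f x)) \<and> \<not> r_sos_convex r f"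
proof -
  obtain K where K: "\<And>x y. x \<noteq> 0 \<Longrightarrow> y \<noteq> 0 \<Longrightarrow> octic_form K x y > 0"
    using octic_form_pos by blast
  obtain R where R: "R > 0" "\<And>P :: real poly poly.
      (\<And>u v. (poly (poly P [:v:]) u)^2 \<le> sextic (R * u) (R * v) 1 * (u^2 + v^2 + 1)^r) \<Longrightarrow>
      (poly (poly P 0) 0)^2 \<noteq> sextic 0 0 1"
    using not_touching_square_sextic[of r] by blast
  let ?f = "scaled_octic K R"
  \<comment> \<open>Stretching by \<open>R > 0\<close> is injective, so the \<open>K\<close> fixed
    beforehand works for every such \<open>R\<close>.\<close>
  have "stretch R x \<noteq> 0" if "x \<noteq> 0" for x
    using that R(1) by (auto simp: stretch_def vec_eq_iff forall_3)
  then have pd: "pos_def (hessian ?f x)" if "x \<noteq> 0" for x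
    using that K unfolding pos_def_def hessian_scaled_octic by blast
  have "\<not> r_sos_convex r ?f"
  proof
    \<comment> \<open>On the plane \<open>x = (u, v, 1)\<close>, \<open>y = (0, 0, 1)\<close>,
      stretching fixes \<open>y\<close>, and only the \<open>zz\<close> entry survives.\<close>
    define e :: "(real^3) \<times> (real^3)" where "e = (axis 3 1, axis 3 1)"
    let ?pt = "\<lambda>u v. e + u *\<^sub>R (axis 1 1, 0) + v *\<^sub>R (axis 2 1, 0)"
    let ?H = "\<lambda>(x, y). (y \<bullet> (hessian ?f x *v y)) * (\<Sum>i\<in>UNIV. (x $ i)^2)^r"
    have H: "?H (?pt u v) = sextic (R * u) (R * v) 1 * (u^2 + v^2 + 1)^r" for u v
      by (simp add: e_def hessian_scaled_octic octic_form_def stretch_def sum_3 axis_def)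
    assume "r_sos_convex r ?f"
    then have "sos ?H" unfolding r_sos_convex_def .
    then obtain q where q: "polyfun q" "\<And>z. (q z)^2 \<le> ?H z" "(q e)^2 = ?H e"
      using sos_touching_square by blast
    obtain P :: "real poly poly" where P: "\<And>u v. q (?pt u v) = poly (poly P [:v:]) u"
      using polyfun_on_plane[OF q(1)] by metis
    have "(poly (poly P [:v:]) u)^2 \<le> sextic (R * u) (R * v) 1 * (u^2 + v^2 + 1)^r" for u v
      using q(2)[of "?pt u v"] unfolding H P .
    moreover have "(poly (poly P 0) 0)^2 = sextic 0 0 1"
      using q(3) P[of 0 0] H[of 0 0] by (simp flip: zero_prod_def)
    ultimately show False using R(2) by blast
  qed
  with pd is_form_scaled_octic show ?thesis by blast
qed

end
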